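(* Let $k\ge 1$ be an integer and let $f:\mathbb{R}^k\to\mathbb{R}$ be any monotone (not necessarily continuous) function. In the multi-objective ($k$-objective) time series search problem described in the context (where the price sets $\mathrm{ITV}_i$ need not be real intervals), for every online algorithm $\mathrm{ALG}_k$ we have $\mathcal{CR}^f(\mathrm{BPP}_k)\le \mathcal{CR}^f(\mathrm{ALG}_k)$, where $\mathrm{BPP}_k$ is the Balanced Price Policy defined in the context.
   Context: Fix reals $0<m_i\le M_i$ for $i=1,\dots,k$. For each $i$, $\mathrm{ITV}_i$ is the set of admissible prices for the $i$-th objective; it is a set of positive reals whose minimum is $m_i$ and whose maximum is $M_i$ (for example the real interval $[m_i,M_i]$ or an integral interval $\{m_i,\dots,M_i\}$). An input is a finite sequence $I=(\vec p_1,\dots,\vec p_T)$, $T\ge1$, of price vectors $\vec p_t=(p_t^1,\dots,p_t^k)\in \mathrm{ITV}_1\times\cdots\times\mathrm{ITV}_k$. A (deterministic) online algorithm $\mathrm{ALG}_k$ knows $m_i,M_i$ for all $i$; at time $t$ it sees $\vec p_t$ and must irrevocably accept or reject it, the decision depending only on $\vec p_1,\dots,\vec p_t$ (not on $T$ or later prices). If it accepts $\vec p_t$ the game ends and its return is $\mathrm{ALG}_k(I)=\vec p_t$; if it rejects every price vector its return is $\mathrm{ALG}_k(I)=(m_1,\dots,m_k)$. For $\vec x,\vec y\in\mathbb{R}^k$, $\vec x\preceq\vec y$ means $x_i\le y_i$ for all $i$; $f$ is monotone if $\vec x\preceq\vec y$ implies $f(\vec x)\le f(\vec y)$. $\mathrm{OPT}_k[I]$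 is the set of maximal price vectors of $I$: those $\vec p_t$ in $I$ for which no price vector $\vec p_s$ of $I$ with $\vec p_s\ne\vec p_t$ satisfies $\vec p_t\preceq\vec p_s$. Define $\mathcal{CR}^f(\mathrm{ALG}_k;I)=\sup_{\vec x\in\mathrm{OPT}_k[I]} f\big(x_1/\mathrm{ALG}_k(I)_1,\dots,x_k/\mathrm{ALG}_k(I)_k\big)$ and $\mathcal{CR}^f(\mathrm{ALG}_k)=\sup_I \mathcal{CR}^f(\mathrm{ALG}_k;I)$, the supremum over all inputs. The Balanced Price Policy $\mathrm{BPP}_k$: for $t=1,2,\dots,T$, accept $\vec p_t$ (the first time this holds) if $f(M_1/p_t^1,\dots,M_k/p_t^k)\le f(p_t^1/m_1,\dots,p_t^k/m_k)$; otherwise reject. *)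

theory Defs
  imports "HOL-Analysis.Analysis"
begin

text \<open>Price vectors are elements of \<open>real ^ 'k\<close>; the number of objectives is \<open>CARD('k)\<close>,
  which is at least 1. The order on \<open>real ^ 'k\<close> is the componentwise one.\<close>

definition inputs :: "('k::finite \<Rightarrow> real set) \<Rightarrow> (real ^ 'k) list set" where
  "inputs ITV = {I. I \<noteq> [] \<and> (\<forall>p \<in> set I. \<forall>i. p $ i \<in> ITV i)}"

text \<open>A deterministic online algorithm maps the nonempty list of price vectors revealed so far to
  its decision on the last of them (\<open>True\<close>: accept). Only the first acceptance counts, see
  \<open>alg_return\<close>, so decisions on lists with an earlier acceptance are irrelevant.\<close>

type_synonym 'k online_alg = "(real ^ 'k) list \<Rightarrow> bool"

definition alg_return :: "real ^ 'k \<Rightarrow> 'k::finite online_alg \<Rightarrow> (real ^ 'k) list \<Rightarrow> real ^ 'k" where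
  "alg_return m A I =
     (if \<exists>t < length I. A (take (Suc t) I)
      then I ! (LEAST t. t < length I \<and> A (take (Suc t) I))
      else m)"

definition opt :: "(real ^ 'k::finite) list \<Rightarrow> (real ^ 'k) set" where
  "opt I = {x \<in> set I. \<not> (\<exists>y \<in> set I. y \<noteq> x \<and> x \<le> y)}"

definition ratio :: "real ^ 'k \<Rightarrow> real ^ 'k \<Rightarrow> real ^ 'k::finite" where
  "ratio x y = (\<chi> i. x $ i / y $ i)"

text \<open>Suprema are taken in the extended reals, so that they need no boundedness side condition.\<close>

definition comp_ratio_on ::
    "(real ^ 'k \<Rightarrow> real) \<Rightarrow> real ^ 'k \<Rightarrow> 'k::finite online_alg \<Rightarrow> (real ^ 'k) list \<Rightarrow> ereal" where
  "comp_ratio_on f m A I = (SUP x \<in> opt I. ereal (f (ratio x (alg_return m A I))))"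

definition comp_ratio ::
    "(real ^ 'k \<Rightarrow> real) \<Rightarrow> real ^ 'k \<Rightarrow> ('k \<Rightarrow> real set) \<Rightarrow> 'k::finite online_alg \<Rightarrow> ereal" where
  "comp_ratio f m ITV A = (SUP I \<in> inputs ITV. comp_ratio_on f m A I)"

definition bpp :: "(real ^ 'k \<Rightarrow> real) \<Rightarrow> real ^ 'k \<Rightarrow> real ^ 'k \<Rightarrow> 'k::finite online_alg" where
  "bpp f m M ps \<longleftrightarrow> f (ratio M (last ps)) \<le> f (ratio (last ps) m)"

end

theory Submission imports Defs begin

text \<open>Every feasible price vector \<open>p\<close> forces
  \<open>min (f (M/p)) (f (p/m)) \<le> CR(ALG)\<close>: if the algorithm accepts \<open>p\<close> when it comes first,
  continue with \<open>M\<close>; if it rejects \<open>p\<close>, stop the input there. The Balanced Price Policy never does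
  worse than such a minimum: when it accepts \<open>p\<close>, its ratio is at most \<open>f (M/p)\<close>, which is the
  smaller term, and when it rejects everything, its ratio is \<open>f (x/m)\<close> for some rejected \<open>x\<close>, for
  which \<open>f (x/m)\<close> is the smaller term.\<close>

lemma ratio_mono_left:
  assumes "x \<le> y" and "\<And>i. 0 < z $ i"
  shows "ratio x z \<le> ratio y z"
  using assms by (simp add: ratio_def less_eq_vec_def divide_right_mono less_imp_le)

text \<open>The first decision sees only \<open>[p]\<close>, so an adversary may choose the
  continuation \<open>I\<close> after learning that \<open>p\<close> is accepted.\<close>

lemma alg_return_accept_first:
  assumes "A [p]"
  shows "alg_return m A (p # I) = p"
proof -
  have "(LEAST t. t < length (p # I) \<and> A (take (Suc t) (p # I))) = 0"
    by (rule Least_eq_0) (use assms in simp)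
  with assms show ?thesis by (auto simp: alg_return_def)
qed

lemma alg_return_accepted:
  assumes "\<exists>t < length I. A (take (Suc t) I)"
  obtains t where "t < length I" and "A (take (Suc t) I)" and "alg_return m A I = I ! t"
  using assms LeastI_ex[of "\<lambda>t. t < length I \<and> A (take (Suc t) I)"]
  by (auto simp: alg_return_def)

lemma comp_ratio_ge:
  assumes "I \<in> inputs ITV" and "x \<in> opt I"
  shows "ereal (f (ratio x (alg_return m A I))) \<le> comp_ratio f m ITV A"
proof -
  have "ereal (f (ratio x (alg_return m A I))) \<le> comp_ratio_on f m A I"
    unfolding comp_ratio_on_def using assms(2) by (rule SUP_upper)
  also have "\<dots> \<le> comp_ratio f m ITV A"
    unfolding comp_ratio_def using assms(1) by (rule SUP_upper)
  finally show ?thesis .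
qed

lemma comp_ratio_lower_bound:
  assumes p: "\<And>i. p $ i \<in> ITV i" and M: "\<And>i. M $ i \<in> ITV i" and "p \<le> M"
  shows "ereal (min (f (ratio M p)) (f (ratio p m))) \<le> comp_ratio f m ITV A"
proof (cases "A [p]")
  case True
  have "[p, M] \<in> inputs ITV" using p M by (simp add: inputs_def)
  \<comment> \<open>By antisymmetry, \<open>M \<le> p\<close> would force \<open>p = M\<close>, so
    no different entry dominates \<open>M\<close>.\<close>
  moreover have "M \<in> opt [p, M]" using \<open>p \<le> M\<close> by (auto simp: opt_def)
  ultimately have "ereal (f (ratio M p)) \<le> comp_ratio f m ITV A"
    using comp_ratio_ge[of "[p, M]" ITV M f m A] alg_return_accept_first[of A p m "[M]"] True
    by simp
  then show ?thesis by (rule order_trans[rotated]) simp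
next
  case False
  have "[p] \<in> inputs ITV" using p by (simp add: inputs_def)
  moreover have "p \<in> opt [p]" by (simp add: opt_def)
  \<comment> \<open>The input ends with nothing accepted, so the default return \<open>m\<close>
    applies.\<close>
  moreover have "alg_return m A [p] = m" using False by (simp add: alg_return_def)
  ultimately have "ereal (f (ratio p m)) \<le> comp_ratio f m ITV A"
    using comp_ratio_ge[of "[p]" ITV p f m A] by simp
  then show ?thesis by (rule order_trans[rotated]) simp
qed

lemma bpp_take_Suc:
  assumes "t < length I"
  shows "bpp f m M (take (Suc t) I) \<longleftrightarrow> f (ratio M (I ! t)) \<le> f (ratio (I ! t) m)"
  using assms by (simp add: bpp_def take_Suc_conv_app_nth)

theorem theorem1:
  fixes f :: "real ^ 'k::finite \<Rightarrow> real"
    and m M :: "real ^ 'k"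
    and ITV :: "'k \<Rightarrow> real set"
    and ALG :: "'k online_alg"
  assumes "\<And>i. 0 < m $ i"
    and "\<And>i. m $ i \<le> M $ i"
    and "\<And>i. m $ i \<in> ITV i \<and> (\<forall>x \<in> ITV i. m $ i \<le> x)"
    and "\<And>i. M $ i \<in> ITV i \<and> (\<forall>x \<in> ITV i. x \<le> M $ i)"
    and "mono f"
  shows "comp_ratio f m ITV (bpp f m M) \<le> comp_ratio f m ITV ALG"
proof -
  have "ereal (f (ratio x (alg_return m (bpp f m M) I))) \<le> comp_ratio f m ITV ALG"
    if I: "I \<in> inputs ITV" and x: "x \<in> opt I" for I x
  proof -
    have feasible: "p $ i \<in> ITV i" if "p \<in> set I" for p i
      using I that by (auto simp: inputs_def)
    have le_M: "p \<le> M" if "p \<in> set I" for p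
      using feasible[OF that] assms(4) by (auto simp: less_eq_vec_def)
    have lower: "ereal (min (f (ratio M p)) (f (ratio p m))) \<le> comp_ratio f m ITV ALG"
      if "p \<in> set I" for p
      using feasible[OF that] le_M[OF that] assms(4) by (intro comp_ratio_lower_bound) auto
    have "x \<in> set I" using x by (simp add: opt_def)
    show ?thesis
    proof (cases "\<exists>t < length I. bpp f m M (take (Suc t) I)")
      case True
      then obtain t where t: "t < length I" "bpp f m M (take (Suc t) I)"
        and ret: "alg_return m (bpp f m M) I = I ! t"
        by (rule alg_return_accepted)
      have "I ! t \<in> set I" using t(1) by simp
      \<comment> \<open>Positive denominators let \<open>x \<le> M\<close> pass to the
        ratios.\<close>
      have "0 < (I ! t) $ i" for i
        using assms(1)[of i] assms(3)[of i] feasible[OF \<open>I ! t \<in> set I\<close>, of i] by force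
      then have "f (ratio x (I ! t)) \<le> f (ratio M (I ! t))"
        using le_M[OF \<open>x \<in> set I\<close>] by (intro monoD[OF \<open>mono f\<close>] ratio_mono_left)
      \<comment> \<open>The acceptance test says exactly that the first term is the smaller
        one.\<close>
      also have "\<dots> = min (f (ratio M (I ! t))) (f (ratio (I ! t) m))"
        using t by (simp add: bpp_take_Suc)
      finally show ?thesis
        using lower[OF \<open>I ! t \<in> set I\<close>] order_trans ereal_less_eq(3) unfolding ret by blast
    next
      case False
      then have "alg_return m (bpp f m M) I = m" unfolding alg_return_def by (rule if_not_P)
      \<comment> \<open>\<open>x\<close> occurs at some position of \<open>I\<close> and was
        rejected there; the failed test makes \<open>f (ratio x m)\<close> the minimum in
        \<open>lower\<close>.\<close>
      moreover have "f (ratio x m) < f (ratio M x)"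
        using False \<open>x \<in> set I\<close> bpp_take_Suc[of _ I f m M] by (force simp: in_set_conv_nth)
      ultimately show ?thesis using lower[OF \<open>x \<in> set I\<close>] by simp
    qed
  qed
  then show ?thesis
    \<comment> \<open>The instantiation opens the suprema on the left side only; the value for
      \<open>ALG\<close> stays folded as their upper bound.\<close>
    unfolding comp_ratio_def[of f m ITV "bpp f m M"] comp_ratio_on_def by (intro SUP_least)
qed

end
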